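(* Let $\alpha\in(0,1)$, $T,L>0$, and let $\phi,\psi$ be positive denominator functions with $\phi(\tau)=\tau^\alpha+\mathcal{O}(\tau^{1+\alpha})$ as $\tau\to0$ and $\psi(h)=h^2+\mathcal{O}(h^3)$ as $h\to0$. Let $\tau=T/N$ and $h=L/M$ with $M,N\in\mathbb{Z}^+$, and suppose $$\frac{\phi(\tau)}{\psi(h)}\le\frac{1-2^{-\alpha}}{\Gamma(2-\alpha)}.$$ Then the solution $(u_m^n)$ of the explicit 1D NSFD scheme (defined in the context) satisfies $$\|u^n\|_\infty\le C\left(\|u^0\|_\infty+\max_{1\le n\le N}\|f^{n-1}\|_\infty\right),\qquad n=1,2,\dots,N,$$ where $C$ is a finite positive constant independent of $\tau$ and $h$.
   Context: The scheme discretizes the problem ${}^{C}D_{0,t}^{\alpha}u=\partial_x^2u+f$ on $[0,L]\times(0,T]$, $u(x,0)=u^0(x)$, $u(0,t)=u(L,t)=0$, where ${}^{C}D_{0,t}^{\alpha}$ is the Caputo derivative in $t$. Grid: $x_m=mh$ ($0\le m\le M$), $t_n=n\tau$ ($0\le n\le N$); $f_m^n=f(x_m,t_n)$. Let $b_{k,\alpha}=k^{1-\alpha}-(k-1)^{1-\alpha}$ for $k\ge1$ and $\mu=\frac{\phi(\tau)\Gamma(2-\alpha)}{\psi(h)}$. Explicit 1D NSFD scheme: for $1\le m\le M-1$, $1\le n\le N$, $$u_m^n=\mu\left(u_{m+1}^{n-1}-2u_m^{n-1}+u_{m-1}^{n-1}\right)+\sum_{k=1}^{n-1}(b_{k,\alpha}-b_{k+1,\alpha})u_m^{n-k}+b_{n,\alpha}u_m^0+\phi(\tau)\Gamma(2-\alpha)f_m^{n-1},$$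 with $u_m^0=u^0(x_m)$ for $0\le m\le M$ and $u_0^n=u_M^n=0$ for $0\le n\le N$. Norms: $\|u^n\|_\infty=\max_{1\le m\le M-1}|u_m^n|$ and $\|f^n\|_\infty=\max_{1\le m\le M-1}|f_m^n|$. *)

theory Defs
  imports "HOL-Analysis.Analysis" "HOL-Library.Landau_Symbols"
begin

(* Meant for k \<ge> 1 and \<alpha> < 1; then b_coeff \<alpha> 1 = 1, since 0 powr (1 - \<alpha>) = 0. *)
definition b_coeff :: "real \<Rightarrow> nat \<Rightarrow> real" where
  "b_coeff \<alpha> k = real k powr (1 - \<alpha>) - (real k - 1) powr (1 - \<alpha>)"

definition grid_x :: "real \<Rightarrow> nat \<Rightarrow> nat \<Rightarrow> real" where
  "grid_x L M m = real m * (L / real M)"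

definition grid_t :: "real \<Rightarrow> nat \<Rightarrow> nat \<Rightarrow> real" where
  "grid_t T N n = real n * (T / real N)"

definition nsfd_mu :: "real \<Rightarrow> (real \<Rightarrow> real) \<Rightarrow> (real \<Rightarrow> real) \<Rightarrow> real \<Rightarrow> real \<Rightarrow> real" where
  "nsfd_mu \<alpha> \<phi> \<psi> \<tau> h = \<phi> \<tau> * Gamma (2 - \<alpha>) / \<psi> h"

(* u m n is the grid value at (x_m, t_n): space index first, time index second.
   Requiring both the initial condition at m = 0, M and the boundary condition at n = 0
   forces the initial datum to vanish at both end points whenever a solution exists. *)
definition explicit_nsfd_1d ::
  "real \<Rightarrow> (real \<Rightarrow> real) \<Rightarrow> (real \<Rightarrow> real) \<Rightarrow> real \<Rightarrow> real \<Rightarrow> nat \<Rightarrow> nat \<Rightarrow>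
   (real \<Rightarrow> real) \<Rightarrow> (real \<Rightarrow> real \<Rightarrow> real) \<Rightarrow> (nat \<Rightarrow> nat \<Rightarrow> real) \<Rightarrow> bool" where
  "explicit_nsfd_1d \<alpha> \<phi> \<psi> T L M N u0 f u \<longleftrightarrow>
     (\<forall>m\<in>{1..M - 1}. \<forall>n\<in>{1..N}.
        u m n =
          nsfd_mu \<alpha> \<phi> \<psi> (T / real N) (L / real M)
            * (u (m + 1) (n - 1) - 2 * u m (n - 1) + u (m - 1) (n - 1))
          + (\<Sum>k = 1..n - 1. (b_coeff \<alpha> k - b_coeff \<alpha> (k + 1)) * u m (n - k))
          + b_coeff \<alpha> n * u m 0
          + \<phi> (T / real N) * Gamma (2 - \<alpha>) * f (grid_x L M m) (grid_t T N (n - 1)))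
     \<and> (\<forall>m\<in>{0..M}. u m 0 = u0 (grid_x L M m))
     \<and> (\<forall>n\<in>{0..N}. u 0 n = 0 \<and> u M n = 0)"

(* For M = 1 there are no interior nodes; the maximum over the empty set is taken to be 0. *)
definition grid_max_norm :: "nat \<Rightarrow> (nat \<Rightarrow> real) \<Rightarrow> real" where
  "grid_max_norm M v = (if M < 2 then 0 else (MAX m\<in>{1..M - 1}. \<bar>v m\<bar>))"

end

(* The restriction on \<phi>/\<psi> says 2 \<mu> \<le> b_1 - b_2, so the coefficient of the central value
   at the previous time level stays nonnegative and the scheme is monotone. Hence the norms v_n of
   the numerical solution satisfy v_n \<le> \<Sum>k. (b_k - b_(k+1)) v_(n-k) + b_n v_0 + G, which by
   induction gives v_n \<le> v_0 + G / b_n. Concavity of x powr (1 - \<alpha>) yields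
   b_n \<ge> (1 - \<alpha>) N powr -\<alpha>, and G / b_n stays bounded because \<phi> (T/N) * N powr \<alpha> does. *)
theory Submission
  imports Defs "HOL-Real_Asymp.Real_Asymp"
begin

section \<open>Size and monotonicity of the coefficients b_k\<close>

text \<open>By the mean value theorem b_k and b_(k+1) are values of (1 - \<alpha>) * z powr
  -\<alpha> on either side of z = k, and this function decreases. The common bound between them
  gives positivity and monotonicity as well as the decay rate.\<close>

lemma b_coeff_bounds:
  assumes "0 < \<alpha>" "\<alpha> < 1" "1 \<le> k"
  shows "(1 - \<alpha>) * real k powr (- \<alpha>) \<le> b_coeff \<alpha> k"
    and "b_coeff \<alpha> (k + 1) \<le> (1 - \<alpha>) * real k powr (- \<alpha>)"
proof -
  have mvt: "\<exists>z. real j < z \<and> z < real j + 1 \<and> b_coeff \<alpha> (j + 1) = (1 - \<alpha>) * z powr (- \<alpha>)" for j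
  proof -
    let ?p = "\<lambda>x. x powr (1 - \<alpha>)"
    have der: "(?p has_real_derivative (1 - \<alpha>) * x powr (- \<alpha>)) (at x)" if "real j < x" for x
      using that by (auto intro!: derivative_eq_intros)
    \<comment> \<open>For j = 0 the left end point is 0, where \<open>?p\<close> is continuous
      because 1 - \<alpha> > 0; the derivative is needed only in the open interval.\<close>
    have "continuous_on {real j..real j + 1} ?p"
      using assms by (intro continuous_on_powr' continuous_intros) auto
    then obtain l z where z: "real j < z" "z < real j + 1" "(?p has_real_derivative l) (at z)"
        "?p (real j + 1) - ?p (real j) = (real j + 1 - real j) * l"
      using MVT[of "real j" "real j + 1" ?p] der by (force simp: real_differentiable_def)
    moreover have "l = (1 - \<alpha>) * z powr (- \<alpha>)"
      using DERIV_unique[OF z(3) der[OF z(1)]] .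
    ultimately show ?thesis by (auto simp: b_coeff_def add.commute intro!: exI[of _ z])
  qed
  obtain z where z: "real (k - 1) < z" "z < real (k - 1) + 1"
      "b_coeff \<alpha> (k - 1 + 1) = (1 - \<alpha>) * z powr (- \<alpha>)"
    using mvt by blast
  have "real k powr (- \<alpha>) \<le> z powr (- \<alpha>)"
    using z assms by (intro powr_mono2') auto
  with z assms show "(1 - \<alpha>) * real k powr (- \<alpha>) \<le> b_coeff \<alpha> k"
    by (simp add: mult_left_mono)
  obtain y where y: "real k < y" "b_coeff \<alpha> (k + 1) = (1 - \<alpha>) * y powr (- \<alpha>)"
    using mvt by blast
  have "y powr (- \<alpha>) \<le> real k powr (- \<alpha>)"
    using y assms by (intro powr_mono2') auto
  with y assms show "b_coeff \<alpha> (k + 1) \<le> (1 - \<alpha>) * real k powr (- \<alpha>)"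
    by (simp add: mult_left_mono)
qed

lemma b_coeff_1 [simp]: "b_coeff \<alpha> 1 = 1" "b_coeff \<alpha> (Suc 0) = 1"
  by (simp_all add: b_coeff_def)

lemma b_coeff_pos: "0 < \<alpha> \<Longrightarrow> \<alpha> < 1 \<Longrightarrow> 1 \<le> k \<Longrightarrow> 0 < b_coeff \<alpha> k"
  by (rule less_le_trans[OF _ b_coeff_bounds(1)]) auto

lemma b_coeff_Suc_le: "0 < \<alpha> \<Longrightarrow> \<alpha> < 1 \<Longrightarrow> 1 \<le> k \<Longrightarrow> b_coeff \<alpha> (Suc k) \<le> b_coeff \<alpha> k"
  using b_coeff_bounds[of \<alpha> k] by simp

section \<open>A discrete fractional Gronwall inequality\<close>

text \<open>The weights b_k - b_(k+1) and b_n are nonnegative with sum b_1 = 1, so each step is a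
  convex combination plus G. The weight b_n falls on \<open>v 0\<close>, which carries no G term,
  and this pays for the new G: (1 - b_n) * (G / b_n) + G = G / b_n.\<close>

lemma discrete_fractional_gronwall:
  fixes b v :: "nat \<Rightarrow> real"
  assumes b1: "b 1 = 1"
    and b_pos: "\<And>k. 1 \<le> k \<Longrightarrow> 0 < b k"
    and b_dec: "\<And>k. 1 \<le> k \<Longrightarrow> b (Suc k) \<le> b k"
    and "0 \<le> G"
    and step: "\<And>n. 1 \<le> n \<Longrightarrow> n \<le> N \<Longrightarrow>
      v n \<le> (\<Sum>k = 1..n - 1. (b k - b (Suc k)) * v (n - k)) + b n * v 0 + G"
    and "1 \<le> n" "n \<le> N"
  shows "v n \<le> v 0 + G / b n"
  using \<open>1 \<le> n\<close> \<open>n \<le> N\<close>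
proof (induction n rule: less_induct)
  case (less n)
  \<comment> \<open>Lets the induction hypotheses at all levels n - k share the bound with G / b_n,
    which then factors out of the sum.\<close>
  have b_le: "b n \<le> b j" if "1 \<le> j" "j \<le> n" for j
    using that(2,1) by (induction rule: inc_induct) (auto intro: order_trans[OF _ b_dec])
  have "(b k - b (Suc k)) * v (n - k) \<le> (b k - b (Suc k)) * (v 0 + G / b n)"
    if "k \<in> {1..n - 1}" for k
  proof (rule mult_left_mono)
    have "v (n - k) \<le> v 0 + G / b (n - k)"
      using that less by (intro less.IH) auto
    also have "G / b (n - k) \<le> G / b n"
      using that less.prems b_pos[of n] \<open>0 \<le> G\<close> by (intro divide_left_mono b_le mult_pos_pos b_pos) auto
    finally show "v (n - k) \<le> v 0 + G / b n" by simp
    show "0 \<le> b k - b (Suc k)" using b_dec[of k] that by simp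
  qed
  then have "(\<Sum>k = 1..n - 1. (b k - b (Suc k)) * v (n - k))
      \<le> (\<Sum>k = 1..n - 1. (b k - b (Suc k)) * (v 0 + G / b n))"
    by (rule sum_mono)
  also have "\<dots> = (\<Sum>k = 1..n - 1. b k - b (Suc k)) * (v 0 + G / b n)"
    by (simp add: sum_distrib_right)
  also have "(\<Sum>k = 1..n - 1. b k - b (Suc k)) = 1 - b n"
    \<comment> \<open>Telescoping; the sign is flipped to match differences of the form f (Suc k) -
      f k.\<close>
    using sum_Suc_diff[of 1 "n - 1" "\<lambda>k. - b k"] b1 less.prems by simp
  finally have "v n \<le> (1 - b n) * (v 0 + G / b n) + b n * v 0 + G"
    using step[OF less.prems] by linarith
  also have "\<dots> = v 0 + G / b n"
    using b_pos[OF less.prems(1)] by (simp add: field_simps)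
  finally show ?case .
qed

section \<open>Maximum norm estimate for one time step\<close>

text \<open>Discrete maximum principle: the weights \<mu>, c - 2 \<mu>, \<mu> of x, y, z are
  nonnegative and add up to c.\<close>

lemma monotone_stencil:
  fixes \<mu> c w x y z :: real
  assumes "0 \<le> \<mu>" "2 * \<mu> \<le> c" "\<bar>x\<bar> \<le> w" "\<bar>y\<bar> \<le> w" "\<bar>z\<bar> \<le> w"
  shows "\<bar>\<mu> * (x - 2 * y + z) + c * y\<bar> \<le> c * w"
proof -
  have "\<mu> * (x - 2 * y + z) + c * y = \<mu> * x + (c - 2 * \<mu>) * y + \<mu> * z"
    by (simp add: algebra_simps)
  also have "\<bar>\<dots>\<bar> \<le> \<bar>\<mu> * x\<bar> + \<bar>(c - 2 * \<mu>) * y\<bar> + \<bar>\<mu> * z\<bar>"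
    by linarith
  also have "\<dots> \<le> \<mu> * w + (c - 2 * \<mu>) * w + \<mu> * w"
    unfolding abs_mult using assms by (intro add_mono mult_mono) auto
  finally show ?thesis by (simp add: algebra_simps)
qed

lemma abs_le_grid_max_norm: "1 \<le> m \<Longrightarrow> m \<le> M - 1 \<Longrightarrow> \<bar>v m\<bar> \<le> grid_max_norm M v"
  by (auto simp: grid_max_norm_def)

lemma grid_max_norm_nonneg: "0 \<le> grid_max_norm M v"
proof (cases "M < 2")
  case False
  then have "\<bar>v 1\<bar> \<le> grid_max_norm M v" by (intro abs_le_grid_max_norm) auto
  then show ?thesis by linarith
qed (simp add: grid_max_norm_def)

lemma grid_max_norm_leI:
  assumes "0 \<le> B" "\<And>m. 1 \<le> m \<Longrightarrow> m \<le> M - 1 \<Longrightarrow> \<bar>v m\<bar> \<le> B"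
  shows "grid_max_norm M v \<le> B"
  using assms by (auto simp: grid_max_norm_def intro!: Max.boundedI)

text \<open>The k = 1 term of the memory sum involves the central value of the stencil, so its
  weight b_1 - b_2 absorbs the -2 \<mu>. All other weights are nonnegative already, and the result
  is the recursion that \<open>discrete_fractional_gronwall\<close> expects.\<close>

lemma explicit_nsfd_1d_norm_step:
  assumes \<alpha>: "0 < \<alpha>" "\<alpha> < 1"
    and \<mu>: "0 \<le> nsfd_mu \<alpha> \<phi> \<psi> (T / real N) (L / real M)"
      "2 * nsfd_mu \<alpha> \<phi> \<psi> (T / real N) (L / real M) \<le> 1 - b_coeff \<alpha> 2"
    and scheme: "explicit_nsfd_1d \<alpha> \<phi> \<psi> T L M N u0 f u"
    and "0 \<le> \<phi> (T / real N)"
    and F: "grid_max_norm M (\<lambda>m. f (grid_x L M m) (grid_t T N (n - 1))) \<le> F"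
    and n: "1 \<le> n" "n \<le> N"
  defines "v \<equiv> \<lambda>n. grid_max_norm M (\<lambda>m. u m n)"
  shows "grid_max_norm M (\<lambda>m. u m n)
    \<le> (\<Sum>k = 1..n - 1. (b_coeff \<alpha> k - b_coeff \<alpha> (Suc k)) * v (n - k))
    + b_coeff \<alpha> n * v 0 + \<phi> (T / real N) * Gamma (2 - \<alpha>) * F"
    (is "_ \<le> ?S + _ + ?g * F")
proof (rule grid_max_norm_leI)
  define \<mu>' where "\<mu>' = nsfd_mu \<alpha> \<phi> \<psi> (T / real N) (L / real M)"
  let ?b = "b_coeff \<alpha>"
  have v0: "0 \<le> v j" for j unfolding v_def by (rule grid_max_norm_nonneg)
  have b0: "0 < ?b k" if "1 \<le> k" for k using b_coeff_pos[OF \<alpha> that] .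
  have bd: "0 \<le> ?b k - ?b (Suc k)" if "1 \<le> k" for k using b_coeff_Suc_le[OF \<alpha> that] by simp
  have g: "0 \<le> ?g" using \<open>0 \<le> \<phi> _\<close> \<alpha> by (intro mult_nonneg_nonneg) (auto intro: less_imp_le Gamma_real_pos)
  have "0 \<le> F" using F grid_max_norm_nonneg order_trans by blast
  then show "0 \<le> ?S + ?b n * v 0 + ?g * F"
    using bd v0 b0[OF n(1)] by (intro add_nonneg_nonneg sum_nonneg mult_nonneg_nonneg g) auto
  fix m assume m: "1 \<le> m" "m \<le> M - 1"
  \<comment> \<open>The norm sees interior nodes only, but the neighbours of m may be 0 or M; there
    the boundary condition helps.\<close>
  have uv: "\<bar>u i j\<bar> \<le> v j" if "i \<le> M" "j \<le> N" for i j
  proof (cases "1 \<le> i \<and> i \<le> M - 1")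
    case True
    then show ?thesis unfolding v_def by (intro abs_le_grid_max_norm) auto
  next
    case False
    then have "i = 0 \<or> i = M" using that by linarith
    then have "u i j = 0" using scheme that by (auto simp: explicit_nsfd_1d_def)
    then show ?thesis using v0 by simp
  qed
  have uv_prev: "\<bar>u (m + 1) (n - 1)\<bar> \<le> v (n - 1)" "\<bar>u m (n - 1)\<bar> \<le> v (n - 1)"
      "\<bar>u (m - 1) (n - 1)\<bar> \<le> v (n - 1)"
    using m n by (auto intro!: uv)
  let ?D = "\<mu>' * (u (m + 1) (n - 1) - 2 * u m (n - 1) + u (m - 1) (n - 1))"
  let ?f = "f (grid_x L M m) (grid_t T N (n - 1))"
  have eq: "u m n = ?D + (\<Sum>k = 1..n - 1. (?b k - ?b (Suc k)) * u m (n - k)) + ?b n * u m 0 + ?g * ?f"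
    using scheme m n unfolding explicit_nsfd_1d_def \<mu>'_def by simp
  have "\<bar>?f\<bar> \<le> F" using abs_le_grid_max_norm[OF m] F order_trans by fastforce
  then have gf: "\<bar>?g * ?f\<bar> \<le> ?g * F" unfolding abs_mult[of ?g] abs_of_nonneg[OF g] using g by (intro mult_left_mono)
  have main: "\<bar>?D + (\<Sum>k = 1..n - 1. (?b k - ?b (Suc k)) * u m (n - k)) + ?b n * u m 0\<bar>
    \<le> ?S + ?b n * v 0"
  \<comment> \<open>At the first step the memory sum is empty and level n - 1 is level 0, so the
    initial term with b_1 = 1 supplies the central weight: the stencil bound is used with c =
    1.\<close>
  proof (cases "n = 1")
    case True
    have "2 * \<mu>' \<le> 1" using \<mu>(2) b0[of 2] unfolding \<mu>'_def by simp
    from monotone_stencil[OF _ this uv_prev] True \<mu>(1) show ?thesis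
      unfolding \<mu>'_def by simp
  next
    case False
    have split: "(\<Sum>k = 1..n - 1. h k) = h 1 + (\<Sum>k = 2..n - 1. h k)" for h :: "nat \<Rightarrow> real"
      using False n by (subst sum.atLeast_Suc_atMost) (auto simp: numeral_2_eq_2)
    \<comment> \<open>Diffusion is grouped with the k = 1 memory term, so c = b_1 - b_2.\<close>
    have head: "\<bar>?D + (1 - ?b 2) * u m (n - 1)\<bar> \<le> (1 - ?b 2) * v (n - 1)"
      using \<mu> unfolding \<mu>'_def by (intro monotone_stencil uv_prev) auto
    have tail: "\<bar>\<Sum>k = 2..n - 1. (?b k - ?b (Suc k)) * u m (n - k)\<bar>
        \<le> (\<Sum>k = 2..n - 1. (?b k - ?b (Suc k)) * v (n - k))"
    proof (rule order_trans[OF sum_abs sum_mono])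
      fix k assume "k \<in> {2..n - 1}"
      then show "\<bar>(?b k - ?b (Suc k)) * u m (n - k)\<bar> \<le> (?b k - ?b (Suc k)) * v (n - k)"
        using bd[of k] uv[of m "n - k"] m n by (simp add: abs_mult mult_left_mono)
    qed
    have "\<bar>?b n * u m 0\<bar> \<le> ?b n * v 0"
      using b0[OF n(1)] uv[of m 0] m by (simp add: abs_mult mult_left_mono)
    with head tail show ?thesis
      unfolding split Suc_1 b_coeff_1(1) by linarith
  qed
  show "\<bar>u m n\<bar> \<le> ?S + ?b n * v 0 + ?g * F"
    unfolding eq using main gf by linarith
qed

section \<open>Uniform control of the time denominator\<close>

text \<open>With \<tau> = T / N the factor N powr \<alpha> cancels the leading \<tau> powr \<alpha>,
  and the remainder is of order 1 / N.\<close>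

lemma denominator_bounded:
  fixes \<phi> :: "real \<Rightarrow> real"
  assumes "0 < T"
    and "(\<lambda>\<tau>. \<phi> \<tau> - \<tau> powr \<alpha>) \<in> O[at_right 0](\<lambda>\<tau>. \<tau> powr (1 + \<alpha>))"
  shows "\<exists>K>0. \<forall>N\<ge>1. \<phi> (T / real N) * real N powr \<alpha> \<le> K"
proof -
  from landau_o.bigE[OF assms(2)] obtain c where c: "c > 0"
    "\<forall>\<^sub>F \<tau> in at_right 0. norm (\<phi> \<tau> - \<tau> powr \<alpha>) \<le> c * norm (\<tau> powr (1 + \<alpha>))" by blast
  have lim: "filterlim (\<lambda>N. T / real N) (at_right 0) sequentially"
    using \<open>0 < T\<close> by real_asymp
  have "\<forall>\<^sub>F N in sequentially.
      norm (\<phi> (T / real N) * real N powr \<alpha>) \<le> T powr \<alpha> + c * T powr (1 + \<alpha>)"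
    using eventually_compose_filterlim[OF c(2) lim] eventually_ge_at_top[of 1]
  proof eventually_elim
    case (elim N)
    then have N: "real N > 0" by simp
    have "\<bar>\<phi> (T / real N)\<bar> \<le> (T / real N) powr \<alpha> + c * (T / real N) powr (1 + \<alpha>)"
      using elim(1) abs_triangle_ineq2[of "\<phi> (T / real N)" "(T / real N) powr \<alpha>"] by simp
    then have "\<bar>\<phi> (T / real N)\<bar> * real N powr \<alpha>
        \<le> ((T / real N) powr \<alpha> + c * (T / real N) powr (1 + \<alpha>)) * real N powr \<alpha>"
      by (intro mult_right_mono) auto
    also have "\<dots> = T powr \<alpha> + c * (T powr (1 + \<alpha>) / real N)"
      using N \<open>0 < T\<close> by (simp add: powr_divide powr_add field_simps)
    also have "\<dots> \<le> T powr \<alpha> + c * T powr (1 + \<alpha>)"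
      using c(1) elim(2) mult_left_mono[of 1 "real N" "T powr (1 + \<alpha>)"]
      by (intro add_left_mono mult_left_mono) (auto simp: divide_le_eq)
    finally show ?case by (simp add: abs_mult)
  qed
  \<comment> \<open>The asymptotic hypothesis speaks only of large N; an eventually bounded sequence
    is bounded, which covers the finitely many other N.\<close>
  then have "Bseq (\<lambda>N. \<phi> (T / real N) * real N powr \<alpha>)"
    by (rule BfunI)
  then obtain K where "K > 0" "\<And>N. norm (\<phi> (T / real N) * real N powr \<alpha>) \<le> K"
    by (auto elim: BseqE)
  then show ?thesis by (intro exI[of _ K]) (auto intro: order_trans[OF abs_ge_self])
qed

section \<open>Stability with a constant uniform in the grid\<close>

theorem theorem5p1:
  fixes \<alpha> T L :: real and \<phi> \<psi> :: "real \<Rightarrow> real"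
  assumes "0 < \<alpha>" and "\<alpha> < 1" and "0 < T" and "0 < L"
    and "\<And>\<tau>. 0 < \<tau> \<Longrightarrow> \<tau> \<le> T \<Longrightarrow> 0 < \<phi> \<tau>"
    and "\<And>h. 0 < h \<Longrightarrow> h \<le> L \<Longrightarrow> 0 < \<psi> h"
    and "(\<lambda>\<tau>. \<phi> \<tau> - \<tau> powr \<alpha>) \<in> O[at_right 0](\<lambda>\<tau>. \<tau> powr (1 + \<alpha>))"
    and "(\<lambda>h. \<psi> h - h ^ 2) \<in> O[at_right 0](\<lambda>h. h ^ 3)"
  shows "\<exists>C>0. \<forall>(M::nat) (N::nat) (u0 :: real \<Rightarrow> real) (f :: real \<Rightarrow> real \<Rightarrow> real)
            (u :: nat \<Rightarrow> nat \<Rightarrow> real).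
          1 \<le> M \<longrightarrow> 1 \<le> N \<longrightarrow>
          \<phi> (T / real N) / \<psi> (L / real M) \<le> (1 - 2 powr (- \<alpha>)) / Gamma (2 - \<alpha>) \<longrightarrow>
          explicit_nsfd_1d \<alpha> \<phi> \<psi> T L M N u0 f u \<longrightarrow>
          (\<forall>n\<in>{1..N}.
             grid_max_norm M (\<lambda>m. u m n)
               \<le> C * (grid_max_norm M (\<lambda>m. u m 0)
                      + (MAX j\<in>{1..N}.
                           grid_max_norm M (\<lambda>m. f (grid_x L M m) (grid_t T N (j - 1))))))"
proof -
  obtain K where K: "K > 0" "\<And>N. 1 \<le> N \<Longrightarrow> \<phi> (T / real N) * real N powr \<alpha> \<le> K"
    using denominator_bounded[OF assms(3,7)] by blast
  have \<Gamma>: "0 < Gamma (2 - \<alpha>)" using assms(2) by (intro Gamma_real_pos) simp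
  \<comment> \<open>Bound for \<phi>(T/N) * Gamma (2 - \<alpha>) / b_n, fixed before M and N are
    chosen.\<close>
  define A where "A = K * Gamma (2 - \<alpha>) / (1 - \<alpha>)"
  have A: "0 < A" using K(1) \<Gamma> assms(2) by (simp add: A_def)
  \<comment> \<open>Translates the mesh restriction \<open>cfl\<close> into 2 \<mu> \<le> b_1 -
    b_2.\<close>
  have b2: "1 - b_coeff \<alpha> 2 = 2 * (1 - 2 powr (- \<alpha>))"
    by (simp add: b_coeff_def powr_diff powr_minus field_simps)
  show ?thesis
  proof (intro exI[of _ "1 + A"] conjI allI impI ballI)
    show "0 < 1 + A" using A by simp
    fix M N :: nat and u0 f u n
    assume M: "1 \<le> M" and N: "1 \<le> N"
      and cfl: "\<phi> (T / real N) / \<psi> (L / real M) \<le> (1 - 2 powr (- \<alpha>)) / Gamma (2 - \<alpha>)"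
      and scheme: "explicit_nsfd_1d \<alpha> \<phi> \<psi> T L M N u0 f u"
      and n: "n \<in> {1..N}"
    \<comment> \<open>The maximum over all time levels makes the forcing term \<open>g * F\<close>
      the same at every step, as the Gronwall lemma requires.\<close>
    define F where "F = (MAX j\<in>{1..N}. grid_max_norm M (\<lambda>m. f (grid_x L M m) (grid_t T N (j - 1))))"
    define v where "v = (\<lambda>n. grid_max_norm M (\<lambda>m. u m n))"
    have F: "grid_max_norm M (\<lambda>m. f (grid_x L M m) (grid_t T N (j - 1))) \<le> F"
      if "1 \<le> j" "j \<le> N" for j
      unfolding F_def using that by (intro Max_ge) auto
    have "0 \<le> F" using F[of 1] N grid_max_norm_nonneg order_trans by blast
    have v0: "0 \<le> v 0" unfolding v_def by (rule grid_max_norm_nonneg)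
    have \<phi>: "0 < \<phi> (T / real N)" using assms(3) N by (intro assms(5)) (auto simp: field_simps)
    have \<psi>: "0 < \<psi> (L / real M)" using assms(4) M by (intro assms(6)) (auto simp: field_simps)
    define g where "g = \<phi> (T / real N) * Gamma (2 - \<alpha>)"
    have g: "0 < g" using \<phi> \<Gamma> by (simp add: g_def)
    have mu0: "0 \<le> nsfd_mu \<alpha> \<phi> \<psi> (T / real N) (L / real M)"
      using \<phi> \<psi> \<Gamma> by (simp add: nsfd_mu_def)
    have mu1: "2 * nsfd_mu \<alpha> \<phi> \<psi> (T / real N) (L / real M) \<le> 1 - b_coeff \<alpha> 2"
      using cfl \<Gamma> by (simp add: b2 nsfd_mu_def pos_le_divide_eq)
    have "v n \<le> v 0 + g * F / b_coeff \<alpha> n"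
    proof (rule discrete_fractional_gronwall)
      show "v j \<le> (\<Sum>k = 1..j - 1. (b_coeff \<alpha> k - b_coeff \<alpha> (Suc k)) * v (j - k))
          + b_coeff \<alpha> j * v 0 + g * F" if "1 \<le> j" "j \<le> N" for j
        unfolding v_def g_def using that assms(1,2) mu0 mu1 scheme \<phi> F[OF that]
        by (intro explicit_nsfd_1d_norm_step) auto
    qed (use n assms(1,2) g \<open>0 \<le> F\<close> in \<open>auto intro: b_coeff_pos b_coeff_Suc_le\<close>)
    also have "g * F / b_coeff \<alpha> n \<le> A * F"
    proof -
      have bn: "0 < b_coeff \<alpha> n" using n assms(1,2) by (intro b_coeff_pos) auto
      \<comment> \<open>Passing from n to N matches the argument T / N of \<phi>, so that
        \<open>K\<close> applies.\<close>
      have "(1 - \<alpha>) * real N powr (- \<alpha>) \<le> (1 - \<alpha>) * real n powr (- \<alpha>)"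
        using n assms(1,2) by (intro mult_left_mono powr_mono2') auto
      also have "\<dots> \<le> b_coeff \<alpha> n"
        using n assms(1,2) by (intro b_coeff_bounds) auto
      finally have "1 - \<alpha> \<le> b_coeff \<alpha> n * real N powr \<alpha>"
        using N by (simp add: powr_minus field_simps)
      then have "\<phi> (T / real N) * (1 - \<alpha>) \<le> \<phi> (T / real N) * (b_coeff \<alpha> n * real N powr \<alpha>)"
        using \<phi> by (intro mult_left_mono) auto
      also have "\<dots> = b_coeff \<alpha> n * (\<phi> (T / real N) * real N powr \<alpha>)" by simp
      also have "\<dots> \<le> b_coeff \<alpha> n * K"
        using bn K(2)[OF N] by (intro mult_left_mono) auto
      finally have "\<phi> (T / real N) / b_coeff \<alpha> n \<le> K / (1 - \<alpha>)"
        using bn assms(2) by (simp add: field_simps)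
      then have "\<phi> (T / real N) / b_coeff \<alpha> n * (Gamma (2 - \<alpha>) * F)
          \<le> K / (1 - \<alpha>) * (Gamma (2 - \<alpha>) * F)"
        using \<Gamma> \<open>0 \<le> F\<close> by (intro mult_right_mono) auto
      then show ?thesis by (simp add: g_def A_def mult_ac)
    qed
    also have "v 0 + A * F \<le> (1 + A) * (v 0 + F)"
      using A v0 \<open>0 \<le> F\<close> by (simp add: algebra_simps)
    finally show "grid_max_norm M (\<lambda>m. u m n) \<le> (1 + A) * (grid_max_norm M (\<lambda>m. u m 0)
        + (MAX j\<in>{1..N}. grid_max_norm M (\<lambda>m. f (grid_x L M m) (grid_t T N (j - 1)))))"
      unfolding v_def F_def by simp
  qed
qed

end
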